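(* Let $S$ be a Clifford semigroup, $\rho$ a congruence on $S$ such that $S/\rho$ is a group, and $\mathcal{R}$ a system of representatives of $S/\rho$. If $\mu:S\to\mathcal{R}$ is a map such that $$\mu(ab)=\mu(a)\,\mu(a)^{-1}\,\mu(ab)$$ for all $a,b\in S$, and $\mu(a)\in[a]_\rho$ for every $a\in S$, then the map $s:S\times S\to S\times S$ given by $$s(a,b)=\left(ab,\ \mu(a)^{-1}\mu(ab)\right),$$ for all $a,b\in S$, is an $\mathrm{E}(S)$-invariant solution on $S$.
   Context: A semigroup $S$ is inverse if for each $a\in S$ there is a unique $a^{-1}\in S$ with $aa^{-1}a=a$ and $a^{-1}aa^{-1}=a^{-1}$; it is a Clifford semigroup if moreover its idempotents are central (equivalently $aa^{-1}=a^{-1}a$ for all $a$). $\mathrm{E}(S)$ is the set of idempotents. $[a]_\rho$ is the $\rho$-class of $a$; a system of representatives of $S/\rho$ is a subset of $S$ containing exactly one element of each $\rho$-class. A solution (of the pentagon equation) on a semigroup $S$ is a map $s:S\times S\to S\times S$, $s(a,b)=(ab,\theta_a(b))$, where $ab$ is the product of $S$ and $\theta_a:S\to S$ are maps satisfying $\theta_a(b)\theta_{ab}(c)=\theta_a(bc)$ and $\theta_{\theta_a(b)}\theta_{ab}=\theta_b$ (composition of maps) for all $a,b,c\in S$. It is $\mathrm{E}(S)$-invariant (idempotent-invariant) if $\theta_a(e)=\theta_a(f)$ for all $a\in S$, $e,f\in\mathrm{E}(S)$. *)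

theory Defs
  imports "HOL-Algebra.Group"
begin

definition (in semigroup_mult) idempotents :: "'a set" where
  "idempotents = {e. e * e = e}"

class inverse_semigroup = semigroup_mult +
  assumes ex1_inverse: "\<exists>!b. a * b * a = a \<and> b * a * b = b"

definition (in inverse_semigroup) sg_inverse :: "'a \<Rightarrow> 'a" where
  "sg_inverse a = (THE b. a * b * a = a \<and> b * a * b = b)"

class clifford_semigroup = inverse_semigroup +
  assumes idempotents_central: "e \<in> idempotents \<Longrightarrow> e * a = a * e"

definition congruence :: "('a::semigroup_mult \<times> 'a) set \<Rightarrow> bool" where
  "congruence \<rho> \<longleftrightarrow> equiv UNIV \<rho> \<and>
     (\<forall>a a' b b'. (a, a') \<in> \<rho> \<longrightarrow> (b, b') \<in> \<rho> \<longrightarrow> (a * b, a' * b') \<in> \<rho>)"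

text \<open>If \<open>\<rho>\<close> is a congruence, the products \<open>a * b\<close> with \<open>a \<in> A\<close> and \<open>b \<in> B\<close> all lie in a
  single class, and \<open>quotient_mult \<rho> A B\<close> is that class.\<close>

definition quotient_mult ::
    "('a::semigroup_mult \<times> 'a) set \<Rightarrow> 'a set \<Rightarrow> 'a set \<Rightarrow> 'a set" where
  "quotient_mult \<rho> A B = \<rho> `` {a * b | a b. a \<in> A \<and> b \<in> B}"

definition quotient_is_group :: "('a::semigroup_mult \<times> 'a) set \<Rightarrow> bool" where
  "quotient_is_group \<rho> \<longleftrightarrow>
     (\<exists>E. group \<lparr>carrier = UNIV // \<rho>, mult = quotient_mult \<rho>, one = E\<rparr>)"

definition system_of_representatives :: "('a \<times> 'a) set \<Rightarrow> 'a set \<Rightarrow> bool" where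
  "system_of_representatives \<rho> R \<longleftrightarrow> (\<forall>C \<in> UNIV // \<rho>. \<exists>!x. x \<in> R \<and> x \<in> C)"

definition theta :: "('a \<times> 'a \<Rightarrow> 'a \<times> 'a) \<Rightarrow> 'a \<Rightarrow> 'a \<Rightarrow> 'a" where
  "theta s a b = snd (s (a, b))"

definition pentagon_solution :: "('a::semigroup_mult \<times> 'a \<Rightarrow> 'a \<times> 'a) \<Rightarrow> bool" where
  "pentagon_solution s \<longleftrightarrow>
     (\<forall>a b. s (a, b) = (a * b, theta s a b)) \<and>
     (\<forall>a b c. theta s a b * theta s (a * b) c = theta s a (b * c)) \<and>
     (\<forall>a b. theta s (theta s a b) \<circ> theta s (a * b) = theta s b)"

definition idempotent_invariant :: "('a::semigroup_mult \<times> 'a \<Rightarrow> 'a \<times> 'a) \<Rightarrow> bool" where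
  "idempotent_invariant s \<longleftrightarrow>
     (\<forall>a. \<forall>e \<in> idempotents. \<forall>f \<in> idempotents. theta s a e = theta s a f)"

end

theory Submission
  imports Defs
begin

text \<open>Idempotents of \<open>S\<close> are sent to the identity of the group \<open>S/\<rho>\<close>, so multiplying by one
  does not change the \<open>\<rho>\<close>-class. Since \<open>\<mu>\<close> is constant on classes, this gives idempotent
  invariance and \<open>\<mu> (\<theta>\<^sub>a(b)) = \<mu> b\<close>, where \<open>\<theta>\<^sub>a(b) = \<mu>(a)\<^sup>-\<^sup>1 \<mu>(ab)\<close>. The hypothesis
  on \<open>\<mu> (ab)\<close> is exactly what collapses \<open>\<theta>\<^sub>a(b) \<theta>\<^sub>a\<^sub>b(c)\<close> to \<open>\<theta>\<^sub>a(bc)\<close>.\<close>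

lemma (in inverse_semigroup) mult_sg_inverse_mult: "a * sg_inverse a * a = a"
  unfolding sg_inverse_def using theI'[OF ex1_inverse[of a]] by blast

lemma (in inverse_semigroup) sg_inverse_mult_idempotent: "sg_inverse a * a \<in> idempotents"
proof -
  have "sg_inverse a * a * (sg_inverse a * a) = sg_inverse a * (a * sg_inverse a * a)"
    by (simp only: mult.assoc)
  then show ?thesis
    by (simp add: idempotents_def mult_sg_inverse_mult)
qed

lemma congruence_equiv: "congruence \<rho> \<Longrightarrow> equiv UNIV \<rho>"
  by (simp add: congruence_def)

lemma congruence_mult:
  "\<lbrakk>congruence \<rho>; (a, a') \<in> \<rho>; (b, b') \<in> \<rho>\<rbrakk> \<Longrightarrow> (a * b, a' * b') \<in> \<rho>"
  by (simp add: congruence_def)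

text \<open>By compatibility all products of members lie in one class, and by reflexivity
  \<open>a * b\<close> is among them. Group laws of the quotient can then be read off on
  elements.\<close>

lemma quotient_mult_class:
  assumes "congruence \<rho>"
  shows "quotient_mult \<rho> (\<rho> `` {a}) (\<rho> `` {b}) = \<rho> `` {a * b}"
proof -
  note eq = congruence_equiv[OF assms]
  have refl: "(x, x) \<in> \<rho>" for x
    using eq by (simp add: equiv_def refl_on_def)
  have class_eq: "\<rho> `` {x * y} = \<rho> `` {a * b}" if "(a, x) \<in> \<rho>" "(b, y) \<in> \<rho>" for x y
    using equiv_class_eq[OF eq congruence_mult[OF assms that]] by simp
  show ?thesis
    unfolding quotient_mult_def using class_eq refl by blast
qed

lemma idempotent_mult_rel:
  assumes "congruence \<rho>" "quotient_is_group \<rho>" "e \<in> idempotents"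
  shows "(e * b, b) \<in> \<rho>" and "(b * e, b) \<in> \<rho>"
proof -
  obtain E where "group \<lparr>carrier = UNIV // \<rho>, mult = quotient_mult \<rho>, one = E\<rparr>"
    (is "group ?G")
    using assms(2) unfolding quotient_is_group_def by blast
  then interpret group ?G .
  have cls: "\<rho> `` {x} \<in> carrier ?G" for x
    by (simp add: quotientI)
  have mult: "\<rho> `` {x} \<otimes>\<^bsub>?G\<^esub> \<rho> `` {y} = \<rho> `` {x * y}" for x y
    by (simp add: quotient_mult_class[OF assms(1)])
  have "\<rho> `` {e} \<otimes>\<^bsub>?G\<^esub> \<rho> `` {e} = \<rho> `` {e}"
    using assms(3) by (simp only: mult idempotents_def mem_Collect_eq)
  \<comment> \<open>Cancellation in a group leaves the identity as its only idempotent.\<close>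
  then have one: "\<rho> `` {e} = \<one>\<^bsub>?G\<^esub>"
    using l_cancel_one[OF cls cls] by blast
  have "\<rho> `` {e * b} = \<rho> `` {b}" and "\<rho> `` {b * e} = \<rho> `` {b}"
    using mult[of e b] mult[of b e] l_one[OF cls, of b] r_one[OF cls, of b] one by metis+
  then show "(e * b, b) \<in> \<rho>" and "(b * e, b) \<in> \<rho>"
    using eq_equiv_class[OF _ congruence_equiv[OF assms(1)]] by blast+
qed

theorem proposition11:
  fixes \<rho> :: "('a::clifford_semigroup \<times> 'a) set"
    and R :: "'a set"
    and \<mu> :: "'a \<Rightarrow> 'a"
    and s :: "'a \<times> 'a \<Rightarrow> 'a \<times> 'a"
  assumes "congruence \<rho>"
    and "quotient_is_group \<rho>"
    and "system_of_representatives \<rho> R"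
    and "\<And>a. \<mu> a \<in> R"
    and "\<And>a b. \<mu> (a * b) = \<mu> a * sg_inverse (\<mu> a) * \<mu> (a * b)"
    and "\<And>a. \<mu> a \<in> \<rho> `` {a}"
    and "\<And>a b. s (a, b) = (a * b, sg_inverse (\<mu> a) * \<mu> (a * b))"
  shows "pentagon_solution s \<and> idempotent_invariant s"
proof -
  note cong = assms(1) and eq = congruence_equiv[OF assms(1)]
  have refl: "(x, x) \<in> \<rho>" for x
    using eq by (simp add: equiv_def refl_on_def)
  have sym: "(y, x) \<in> \<rho>" if "(x, y) \<in> \<rho>" for x y
    using eq that by (meson equivE symE)
  have trans: "(x, z) \<in> \<rho>" if "(x, y) \<in> \<rho>" "(y, z) \<in> \<rho>" for x y z
    using eq that by (meson equivE transE)
  have mu_rel: "(a, \<mu> a) \<in> \<rho>" for a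
    using assms(6) by simp
  have mu_cong: "\<mu> a = \<mu> b" if "(a, b) \<in> \<rho>" for a b
  proof -
    have "\<rho> `` {a} \<in> UNIV // \<rho>"
      by (simp add: quotientI)
    then have "\<exists>!x. x \<in> R \<and> x \<in> \<rho> `` {a}"
      using assms(3) unfolding system_of_representatives_def by blast
    \<comment> \<open>Both \<open>\<mu> a\<close> and \<open>\<mu> b\<close> are thus the unique
      member of \<open>R\<close> in the class of \<open>a\<close>.\<close>
    moreover have "\<mu> b \<in> \<rho> `` {a}"
      using trans[OF that mu_rel] by simp
    ultimately show ?thesis
      using assms(4,6) by blast
  qed
  have theta: "theta s a b = sg_inverse (\<mu> a) * \<mu> (a * b)" for a b
    by (simp add: theta_def assms(7))
  have theta_rel: "(theta s a b, b) \<in> \<rho>" for a b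
  proof -
    \<comment> \<open>Modulo \<open>\<rho>\<close>, \<open>\<mu> (a * b)\<close> may be split as
      \<open>\<mu> a * b\<close>; the factor \<open>sg_inverse (\<mu> a)\<close> then completes an
      idempotent in front of \<open>b\<close>.\<close>
    have "(\<mu> (a * b), \<mu> a * b) \<in> \<rho>"
      using trans[OF sym[OF mu_rel] congruence_mult[OF cong mu_rel refl]] .
    from congruence_mult[OF cong refl this]
    have "(theta s a b, sg_inverse (\<mu> a) * \<mu> a * b) \<in> \<rho>"
      by (simp add: theta mult.assoc)
    then show ?thesis
      using trans idempotent_mult_rel(1)[OF assms(1,2) sg_inverse_mult_idempotent] by blast
  qed
  \<comment> \<open>The hypothesis at \<open>a * b\<close> and \<open>c\<close> absorbs the inner
    factor \<open>\<mu> (a * b) * sg_inverse (\<mu> (a * b))\<close>.\<close>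
  have mult: "theta s a b * theta s (a * b) c = theta s a (b * c)" for a b c
    using assms(5)[of "a * b" c] by (simp add: theta mult.assoc)
  \<comment> \<open>The outer map takes \<open>\<mu>\<close> of a product that \<open>mult\<close>
    turns into \<open>theta s a (b * c)\<close>; by \<open>theta_rel\<close> its value is
    \<open>\<mu> (b * c)\<close>.\<close>
  have comp: "theta s (theta s a b) (theta s (a * b) c) = theta s b c" for a b c
    unfolding theta[of "theta s a b"] mult mu_cong[OF theta_rel] theta[of b] ..
  \<comment> \<open>Since \<open>a * e\<close> lies in the class of \<open>a\<close>,
    \<open>\<mu> (a * e)\<close> is \<open>\<mu> a\<close>, and \<open>e\<close> disappears.\<close>
  have inv: "theta s a e = sg_inverse (\<mu> a) * \<mu> a" if "e \<in> idempotents" for a e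
    by (simp add: theta mu_cong[OF idempotent_mult_rel(2)[OF assms(1,2) that]])
  show ?thesis
    unfolding pentagon_solution_def idempotent_invariant_def
    using assms(7) mult comp inv by (simp add: fun_eq_iff theta_def)
qed

end
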